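(* Let $X$ be a poset and $\mathbb{Z}_2$ the field with two elements. Let $\lambda$ be an endomorphism of the abelian group $(\mathcal{P}(X),\triangle)$ with $\lambda(X)=X$, let $\psi:FI(X,\mathbb{Z}_2)\to J(FI(X,\mathbb{Z}_2))$ be a linear map with $\psi(\delta)=0$, and let $\varphi:FI(X,\mathbb{Z}_2)\to FI(X,\mathbb{Z}_2)$ be the unital linear invertibility preserver given by $\varphi(\alpha)=e_{\lambda(L_1(\alpha))}+\psi(\alpha)$. Then $\varphi$ is strong if and only if $\lambda$ is injective.
   Context: The finitary incidence algebra $FI(X,K)$ of a poset $(X,\le)$ over a field $K$ is the $K$-space of formal sums $\alpha=\sum_{x\le y}\alpha_{xy}e_{xy}$ ($x,y\in X$, $\alpha_{xy}\in K$, $e_{xy}$ symbols) such that for all $x<y$ the set of pairs $(u,v)$ with $x\le u<v\le y$ and $\alpha_{uv}\neq 0$ is finite. The product is $\alpha\beta=\sum_{x\le y}\big(\sum_{x\le z\le y}\alpha_{xz}\beta_{zy}\big)e_{xy}$; it is a unital associative algebra with identity $\delta=\sum_{x\in X}e_{xx}$. For $A\subseteq X$, $e_A=\sum_{x\in A}e_{xx}$. Put $J(FI(X,K))=\{\alpha\in FI(X,K)\mid \alpha_{xx}=0\ \forall x\in X\}$ (this is the Jacobson radical), and $L_1(\alpha)=\{x\in X\mid \alpha_{xx}=1\}$. A map $\varphi:A\to A$ on a unital associative algebra $A$ is an invertibility preserver of $A$ if $\varphi(U(A))\subseteq U(A)$, where $U(A)$ is the group of units; it is unital if $\varphi(1_A)=1_A$.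 An invertibility preserver $\varphi$ of $A$ is strong if for all $a\in A$: $a\in U(A)\iff\varphi(a)\in U(A)$. $\mathcal{P}(X)$ is the set of all subsets of $X$, and $A\triangle B=(A\setminus B)\cup(B\setminus A)$ is the symmetric difference, under which $\mathcal{P}(X)$ is an abelian group. *)

theory Defs
  imports "HOL-Algebra.Module" "HOL-Library.Z2"
begin

text \<open>
  A poset is a set \<open>X\<close> with a relation \<open>r\<close> such that \<^term>\<open>partial_order_on X r\<close>, where
  \<open>(x, y) \<in> r\<close> means \<open>x \<le> y\<close>. The formal sum of the \<open>\<alpha>\<^sub>x\<^sub>y e\<^sub>x\<^sub>y\<close> over \<open>x \<le> y\<close> is the function
  \<open>\<alpha>\<close> of two arguments that vanishes at all \<open>(x, y) \<notin> r\<close>.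
\<close>

definition FI_carrier :: "'a rel \<Rightarrow> ('a \<Rightarrow> 'a \<Rightarrow> 'k::field) set" where
  "FI_carrier r =
    {\<alpha>. (\<forall>x y. (x, y) \<notin> r \<longrightarrow> \<alpha> x y = 0) \<and>
        (\<forall>x y. (x, y) \<in> r \<and> x \<noteq> y \<longrightarrow>
          finite {(u, v). (x, u) \<in> r \<and> (u, v) \<in> r \<and> u \<noteq> v \<and> (v, y) \<in> r \<and> \<alpha> u v \<noteq> 0})}"

text \<open>
  An interval of \<open>X\<close> may be infinite, and a HOL sum over an infinite set is 0. The sum in the
  product is therefore restricted to the nonzero summands; for members of \<^const>\<open>FI_carrier\<close>
  there are finitely many of them.
\<close>

definition FI_mult ::
    "'a rel \<Rightarrow> ('a \<Rightarrow> 'a \<Rightarrow> 'k::field) \<Rightarrow> ('a \<Rightarrow> 'a \<Rightarrow> 'k) \<Rightarrow> ('a \<Rightarrow> 'a \<Rightarrow> 'k)" where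
  "FI_mult r \<alpha> \<beta> =
    (\<lambda>x y. \<Sum>z\<in>{z. (x, z) \<in> r \<and> (z, y) \<in> r \<and> \<alpha> x z * \<beta> z y \<noteq> 0}. \<alpha> x z * \<beta> z y)"

definition diag_idem :: "'a set \<Rightarrow> 'a \<Rightarrow> 'a \<Rightarrow> 'k::field" where
  "diag_idem A = (\<lambda>x y. if x = y \<and> x \<in> A then 1 else 0)"

text \<open>The field of scalars is the type \<open>'k\<close> itself.\<close>

definition FI :: "'a set \<Rightarrow> 'a rel \<Rightarrow> ('k::field, 'a \<Rightarrow> 'a \<Rightarrow> 'k) module" where
  "FI X r =
    \<lparr>carrier = FI_carrier r,
     mult = FI_mult r,
     one = diag_idem X,
     zero = (\<lambda>x y. 0),
     add = (\<lambda>\<alpha> \<beta> x y. \<alpha> x y + \<beta> x y),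
     smult = (\<lambda>c \<alpha> x y. c * \<alpha> x y)\<rparr>"

definition FI_J :: "'a set \<Rightarrow> 'a rel \<Rightarrow> ('a \<Rightarrow> 'a \<Rightarrow> 'k::field) set" where
  "FI_J X r = {\<alpha> \<in> carrier (FI X r). \<forall>x\<in>X. \<alpha> x x = 0}"

definition L1 :: "'a set \<Rightarrow> ('a \<Rightarrow> 'a \<Rightarrow> 'k::field) \<Rightarrow> 'a set" where
  "L1 X \<alpha> = {x \<in> X. \<alpha> x x = 1}"

text \<open>\<open>S\<close> is meant to be a linear subspace of \<open>M\<close>; its operations are those of \<open>M\<close>.\<close>

definition linear_into :: "('k, 'm) module \<Rightarrow> 'm set \<Rightarrow> ('m \<Rightarrow> 'm) \<Rightarrow> bool" where
  "linear_into M S f \<longleftrightarrow>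
    f \<in> carrier M \<rightarrow> S \<and>
    (\<forall>a\<in>carrier M. \<forall>b\<in>carrier M. f (a \<oplus>\<^bsub>M\<^esub> b) = f a \<oplus>\<^bsub>M\<^esub> f b) \<and>
    (\<forall>c. \<forall>a\<in>carrier M. f (c \<odot>\<^bsub>M\<^esub> a) = c \<odot>\<^bsub>M\<^esub> f a)"

definition unital_map :: "('m, 'z) monoid_scheme \<Rightarrow> ('m \<Rightarrow> 'm) \<Rightarrow> bool" where
  "unital_map A f \<longleftrightarrow> f \<one>\<^bsub>A\<^esub> = \<one>\<^bsub>A\<^esub>"

definition invertibility_preserver :: "('m, 'z) monoid_scheme \<Rightarrow> ('m \<Rightarrow> 'm) \<Rightarrow> bool" where
  "invertibility_preserver A f \<longleftrightarrow> f \<in> carrier A \<rightarrow> carrier A \<and> f ` Units A \<subseteq> Units A"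

definition strong_invertibility_preserver :: "('m, 'z) monoid_scheme \<Rightarrow> ('m \<Rightarrow> 'm) \<Rightarrow> bool" where
  "strong_invertibility_preserver A f \<longleftrightarrow>
    invertibility_preserver A f \<and> (\<forall>a\<in>carrier A. a \<in> Units A \<longleftrightarrow> f a \<in> Units A)"

definition Pow_group :: "'a set \<Rightarrow> 'a set monoid" where
  "Pow_group X = \<lparr>carrier = Pow X, mult = (\<lambda>A B. sym_diff A B), one = {}\<rparr>"

end

theory Submission
  imports Defs
begin

text \<open>
  An element of \<open>FI X r\<close> is a unit iff its diagonal has no zeros; over \<open>\<int>\<^sub>2\<close> this says that
  \<open>L1 X \<alpha> = X\<close>. Since \<open>\<psi>\<close> does not affect the diagonal, \<open>\<phi> \<alpha>\<close> is a unit iff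
  \<open>lam (L1 X \<alpha>) = X = lam X\<close>, and every subset of \<open>X\<close> is \<open>L1 X \<alpha>\<close> for some \<open>\<alpha>\<close>. So \<open>\<phi>\<close> is strong
  iff \<open>lam\<close> takes the value \<open>X\<close> only at \<open>X\<close>, that is, iff the homomorphism \<open>lam\<close> has trivial kernel.
\<close>

section \<open>Supports and finiteness\<close>

text \<open>The set that \<open>FI_carrier\<close> requires to be finite. It gets a name because its
  cardinality later serves as the termination measure for computing inverses.\<close>

definition FI_supp :: "'a rel \<Rightarrow> ('a \<Rightarrow> 'a \<Rightarrow> 'k::field) \<Rightarrow> 'a \<Rightarrow> 'a \<Rightarrow> ('a \<times> 'a) set" where
  "FI_supp r \<alpha> x y = {(u, v). (x, u) \<in> r \<and> (u, v) \<in> r \<and> u \<noteq> v \<and> (v, y) \<in> r \<and> \<alpha> u v \<noteq> 0}"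

lemma FI_carrier_zero: "\<alpha> \<in> FI_carrier r \<Longrightarrow> (x, y) \<notin> r \<Longrightarrow> \<alpha> x y = 0"
  by (simp add: FI_carrier_def)

lemma FI_carrier_iff:
  "\<alpha> \<in> FI_carrier r \<longleftrightarrow>
    (\<forall>x y. (x, y) \<notin> r \<longrightarrow> \<alpha> x y = 0) \<and> (\<forall>x y. (x, y) \<in> r \<and> x \<noteq> y \<longrightarrow> finite (FI_supp r \<alpha> x y))"
  by (simp add: FI_carrier_def FI_supp_def)

text \<open>The index set in \<open>FI_mult\<close> depends on both factors. Enlarging it to any
  finite \<open>S\<close> adds only zero summands, since members of \<open>FI_carrier\<close> vanish
  off \<open>r\<close>; sums can then be compared over a common set.\<close>

lemma FI_mult_eq_sum:
  assumes "\<alpha> \<in> FI_carrier r" "\<beta> \<in> FI_carrier r" "finite S"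
    and "\<And>z. (x, z) \<in> r \<Longrightarrow> (z, y) \<in> r \<Longrightarrow> \<alpha> x z * \<beta> z y \<noteq> 0 \<Longrightarrow> z \<in> S"
  shows "FI_mult r \<alpha> \<beta> x y = (\<Sum>z\<in>S. \<alpha> x z * \<beta> z y)"
  unfolding FI_mult_def
  using assms by (intro sum.mono_neutral_left) (auto dest: FI_carrier_zero)

lemma diag_idem_carrier:
  assumes "refl_on X r" "A \<subseteq> X"
  shows "diag_idem A \<in> FI_carrier r"
proof -
  have "FI_supp r (diag_idem A :: _ \<Rightarrow> _ \<Rightarrow> 'b) x y = {}" for x y
    by (auto simp: FI_supp_def diag_idem_def)
  then show ?thesis
    using assms by (auto simp: FI_carrier_iff diag_idem_def dest: refl_onD)
qed

context
  fixes X :: "'a set" and r :: "'a rel"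
  assumes poset: "partial_order_on X r"
begin

lemma
  shows poset_refl: "refl_on X r" and poset_antisym: "antisym r"
    and poset_trans: "trans r" and poset_sub: "r \<subseteq> X \<times> X"
  using poset by (auto simp: partial_order_on_def preorder_on_def)

text \<open>The carrier condition covers x < y. For all other pairs the support is empty: a member
  (u, v) would give x \<le> u < v \<le> y and hence x < y.\<close>

lemma finite_FI_supp:
  assumes "\<alpha> \<in> FI_carrier r"
  shows "finite (FI_supp r \<alpha> x y)"
proof (cases "(x, y) \<in> r \<and> x \<noteq> y")
  case True
  then show ?thesis using assms by (simp add: FI_carrier_iff)
next
  case False
  then have "FI_supp r \<alpha> x y = {}"
    using poset_trans poset_antisym
    unfolding FI_supp_def by (auto dest: transD antisymD)
  then show ?thesis by simp
qed

section \<open>Diagonal, identity and associativity of the product\<close>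

text \<open>By antisymmetry the interval from x to x contains at most x.\<close>

lemma FI_mult_diag:
  assumes "\<alpha> \<in> FI_carrier r" "\<beta> \<in> FI_carrier r"
  shows "FI_mult r \<alpha> \<beta> x x = \<alpha> x x * \<beta> x x"
  using FI_mult_eq_sum[OF assms, of "{x}" x x] poset_antisym by (auto dest: antisymD)

lemma FI_mult_outside:
  assumes "(x, y) \<notin> r"
  shows "FI_mult r \<alpha> \<beta> x y = 0"
  unfolding FI_mult_def using assms poset_trans by (auto dest: transD intro: sum.neutral)

lemma FI_mult_one:
  assumes \<alpha>: "\<alpha> \<in> FI_carrier r"
  shows "FI_mult r (diag_idem X) \<alpha> = \<alpha>" "FI_mult r \<alpha> (diag_idem X) = \<alpha>"
proof -
  have D: "diag_idem X \<in> FI_carrier r" by (rule diag_idem_carrier[OF poset_refl]) simp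
  have "FI_mult r (diag_idem X) \<alpha> x y = \<alpha> x y" for x y
  proof -
    have "FI_mult r (diag_idem X) \<alpha> x y = (\<Sum>z\<in>{x}. diag_idem X x z * \<alpha> z y)"
      by (intro FI_mult_eq_sum D \<alpha>) (auto simp: diag_idem_def split: if_splits)
    then show ?thesis
      using FI_carrier_zero[OF \<alpha>, of x y] poset_sub by (auto simp: diag_idem_def)
  qed
  moreover have "FI_mult r \<alpha> (diag_idem X) x y = \<alpha> x y" for x y
  proof -
    have "FI_mult r \<alpha> (diag_idem X) x y = (\<Sum>z\<in>{y}. \<alpha> x z * diag_idem X z y)"
      by (intro FI_mult_eq_sum D \<alpha>) (auto simp: diag_idem_def split: if_splits)
    then show ?thesis
      using FI_carrier_zero[OF \<alpha>, of x y] poset_sub by (auto simp: diag_idem_def)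
  qed
  ultimately show "FI_mult r (diag_idem X) \<alpha> = \<alpha>" "FI_mult r \<alpha> (diag_idem X) = \<alpha>"
    by (intro ext, simp)+
qed

text \<open>All sums involved in one entry of the product can be taken over the same finite set \<open>S\<close>.\<close>

lemma FI_mult_assoc:
  assumes \<alpha>: "\<alpha> \<in> FI_carrier r" and \<beta>: "\<beta> \<in> FI_carrier r" and \<gamma>: "\<gamma> \<in> FI_carrier r"
    and \<alpha>\<beta>: "FI_mult r \<alpha> \<beta> \<in> FI_carrier r" and \<beta>\<gamma>: "FI_mult r \<beta> \<gamma> \<in> FI_carrier r"
  shows "FI_mult r (FI_mult r \<alpha> \<beta>) \<gamma> = FI_mult r \<alpha> (FI_mult r \<beta> \<gamma>)"
proof (intro ext)
  fix x y
  \<comment> \<open>\<open>S\<close> contains every w in the interval with \<alpha> x w or \<gamma>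
    w y nonzero. The endpoints are added by hand because \<open>FI_supp\<close> omits diagonal
    entries.\<close>
  define S where "S = {x, y} \<union> snd ` FI_supp r \<alpha> x y \<union> fst ` FI_supp r \<gamma> x y"
  have fin: "finite S"
    unfolding S_def using finite_FI_supp[OF \<alpha>] finite_FI_supp[OF \<gamma>] by simp
  have S\<alpha>: "w \<in> S" if "(x, w) \<in> r" "(w, y) \<in> r" "\<alpha> x w \<noteq> 0" for w
  proof (cases "w = x")
    case False
    have "(x, x) \<in> r" using that(1) poset_sub poset_refl by (auto dest: refl_onD)
    then have "(x, w) \<in> FI_supp r \<alpha> x y" using that False by (auto simp: FI_supp_def)
    then show ?thesis by (force simp: S_def)
  qed (simp add: S_def)
  have S\<gamma>: "w \<in> S" if "(x, w) \<in> r" "(w, y) \<in> r" "\<gamma> w y \<noteq> 0" for w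
  proof (cases "w = y")
    case False
    have "(y, y) \<in> r" using that(2) poset_sub poset_refl by (auto dest: refl_onD)
    then have "(w, y) \<in> FI_supp r \<gamma> x y" using that False by (auto simp: FI_supp_def)
    then show ?thesis by (force simp: S_def)
  qed (simp add: S_def)
  \<comment> \<open>For z \<le> y the intermediate w lie below y, so \<open>S\<close> catches them;
    for all other z the factor \<gamma> z y annihilates both sides. The equation for
    \<open>rr\<close> is dual.\<close>
  have l: "FI_mult r \<alpha> \<beta> x z * \<gamma> z y = (\<Sum>w\<in>S. \<alpha> x w * \<beta> w z * \<gamma> z y)" for z
  proof (cases "(z, y) \<in> r")
    case True
    then have "FI_mult r \<alpha> \<beta> x z = (\<Sum>w\<in>S. \<alpha> x w * \<beta> w z)"
      using poset_trans S\<alpha> by (intro FI_mult_eq_sum \<alpha> \<beta> fin) (auto dest: transD)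
    then show ?thesis by (simp add: sum_distrib_right)
  qed (simp add: FI_carrier_zero[OF \<gamma>])
  have rr: "\<alpha> x w * FI_mult r \<beta> \<gamma> w y = (\<Sum>z\<in>S. \<alpha> x w * \<beta> w z * \<gamma> z y)" for w
  proof (cases "(x, w) \<in> r")
    case True
    then have "FI_mult r \<beta> \<gamma> w y = (\<Sum>z\<in>S. \<beta> w z * \<gamma> z y)"
      using poset_trans S\<gamma> by (intro FI_mult_eq_sum \<beta> \<gamma> fin) (auto dest: transD)
    then show ?thesis by (simp add: sum_distrib_left mult.assoc)
  qed (simp add: FI_carrier_zero[OF \<alpha>])
  have "FI_mult r (FI_mult r \<alpha> \<beta>) \<gamma> x y = (\<Sum>z\<in>S. FI_mult r \<alpha> \<beta> x z * \<gamma> z y)"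
    using S\<gamma> by (intro FI_mult_eq_sum \<alpha>\<beta> \<gamma> fin) auto
  also have "\<dots> = (\<Sum>z\<in>S. \<Sum>w\<in>S. \<alpha> x w * \<beta> w z * \<gamma> z y)" by (simp only: l)
  also have "\<dots> = (\<Sum>w\<in>S. \<Sum>z\<in>S. \<alpha> x w * \<beta> w z * \<gamma> z y)" by (rule sum.swap)
  also have "\<dots> = (\<Sum>w\<in>S. \<alpha> x w * FI_mult r \<beta> \<gamma> w y)" by (simp only: rr)
  also have "\<dots> = FI_mult r \<alpha> (FI_mult r \<beta> \<gamma>) x y"
    using S\<alpha> by (intro FI_mult_eq_sum[symmetric] \<alpha> \<beta>\<gamma> fin) auto
  finally show "FI_mult r (FI_mult r \<alpha> \<beta>) \<gamma> x y = FI_mult r \<alpha> (FI_mult r \<beta> \<gamma>) x y" .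
qed

section \<open>Inverses and units\<close>

text \<open>
  The equation \<open>\<beta>\<alpha> = \<delta>\<close> determines \<open>\<beta>\<^sub>x\<^sub>y\<close> from the \<open>\<beta>\<^sub>x\<^sub>z\<close> with \<open>x \<le> z < y\<close> and \<open>\<alpha>\<^sub>z\<^sub>y \<noteq> 0\<close>. This recursion
  terminates because \<open>(z, y)\<close> is in \<open>FI_supp r \<alpha> x y\<close> but not in \<open>FI_supp r \<alpha> x z\<close>.
\<close>

lemma FI_left_inverse:
  assumes \<alpha>: "\<alpha> \<in> FI_carrier r" and nz: "\<And>x. x \<in> X \<Longrightarrow> \<alpha> x x \<noteq> 0"
  obtains \<beta> where "\<beta> \<in> FI_carrier r" "FI_mult r \<beta> \<alpha> = diag_idem X"
proof -
  define Z where "Z = (\<lambda>x y. {z. (x, z) \<in> r \<and> (z, y) \<in> r \<and> z \<noteq> y \<and> \<alpha> z y \<noteq> 0})"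
  define H where "H = (\<lambda>f (x, y). if x = y then inverse (\<alpha> x x)
    else - (\<Sum>z\<in>Z x y. f (x, z) * \<alpha> z y) * inverse (\<alpha> y y))"
  define R where "R = measure (\<lambda>(x, y). card (FI_supp r \<alpha> x y))"
  define \<beta> where "\<beta> = (\<lambda>x y. wfrec R H (x, y))"
  have refl: "(y, y) \<in> r" if "(x, y) \<in> r \<or> (y, x) \<in> r" for x y
    using that poset_sub poset_refl by (auto dest: refl_onD)
  have Z_supp: "(z, y) \<in> FI_supp r \<alpha> x y" if "z \<in> Z x y" for x y z
    using that refl by (auto simp: Z_def FI_supp_def)
  have dec: "((x, z), (x, y)) \<in> R" if "z \<in> Z x y" for x y z
  proof -
    have "FI_supp r \<alpha> x z \<subseteq> FI_supp r \<alpha> x y"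
      using that poset_trans by (auto simp: Z_def FI_supp_def dest: transD)
    moreover have "(z, y) \<notin> FI_supp r \<alpha> x z"
      using that poset_antisym by (auto simp: Z_def FI_supp_def dest: antisymD)
    ultimately have "FI_supp r \<alpha> x z \<subset> FI_supp r \<alpha> x y" using Z_supp[OF that] by blast
    then show ?thesis
      using finite_FI_supp[OF \<alpha>] by (auto simp: R_def intro: psubset_card_mono)
  qed
  have \<beta>_rec: "\<beta> x y = (if x = y then inverse (\<alpha> x x)
      else - (\<Sum>z\<in>Z x y. \<beta> x z * \<alpha> z y) * inverse (\<alpha> y y))" for x y
  proof -
    have "\<beta> x y = H (cut (wfrec R H) R (x, y)) (x, y)"
      unfolding \<beta>_def by (rule wfrec) (simp add: R_def)
    also have "\<dots> = (if x = y then inverse (\<alpha> x x)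
      else - (\<Sum>z\<in>Z x y. \<beta> x z * \<alpha> z y) * inverse (\<alpha> y y))"
      by (simp add: H_def \<beta>_def cut_apply dec cong: sum.cong)
    finally show ?thesis .
  qed
  have finZ: "finite (Z x y)" for x y
    using finite_FI_supp[OF \<alpha>, of x y] Z_supp[of _ x y]
    by (intro finite_subset[of "Z x y" "fst ` FI_supp r \<alpha> x y"]) force+
  \<comment> \<open>For a diagonal pair outside \<open>X\<close> this relies on
    \<open>inverse 0 = 0\<close>.\<close>
  have \<beta>_zero: "\<beta> x y = 0" if "(x, y) \<notin> r" for x y
  proof -
    have "Z x y = {}" using that poset_trans by (auto simp: Z_def dest: transD)
    then show ?thesis using FI_carrier_zero[OF \<alpha> that] by (auto simp: \<beta>_rec)
  qed
  \<comment> \<open>A nonzero \<beta> u v comes from a chain from u to v along which \<alpha> is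
    nonzero. Following the recursion down until z = u yields the first link of such a chain.\<close>
  have start: "\<exists>w. (u, w) \<in> r \<and> u \<noteq> w \<and> (w, v) \<in> r \<and> \<alpha> u w \<noteq> 0"
    if "\<beta> u v \<noteq> 0" "u \<noteq> v" for u v
    using that
  proof (induction "card (FI_supp r \<alpha> u v)" arbitrary: v rule: less_induct)
    case less
    then have "(\<Sum>z\<in>Z u v. \<beta> u z * \<alpha> z v) \<noteq> 0" by (auto simp: \<beta>_rec[of u v])
    then obtain z where z: "z \<in> Z u v" "\<beta> u z \<noteq> 0"
      by (metis (mono_tags, lifting) mult_zero_left sum.neutral)
    show ?case
    proof (cases "z = u")
      case True
      then show ?thesis using z refl by (auto simp: Z_def)
    next
      case False
      then obtain w where "(u, w) \<in> r" "u \<noteq> w" "(w, z) \<in> r" "\<alpha> u w \<noteq> 0"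
        using less.hyps[of z] dec[OF z(1)] z(2) by (auto simp: R_def)
      then show ?thesis using z(1) poset_trans by (auto simp: Z_def dest: transD)
    qed
  qed
  \<comment> \<open>The first link of the chain starts at u and the last one ends at v. Both links
    lie in \<open>FI_supp r \<alpha> x y\<close>, which leaves finitely many choices for u and for
    v.\<close>
  have "finite (FI_supp r \<beta> x y)" for x y
  proof (rule finite_subset)
    show "FI_supp r \<beta> x y \<subseteq> fst ` FI_supp r \<alpha> x y \<times> snd ` FI_supp r \<alpha> x y"
    proof (rule subrelI)
      fix u v assume uv: "(u, v) \<in> FI_supp r \<beta> x y"
      then have a: "(x, u) \<in> r" "(u, v) \<in> r" "u \<noteq> v" "(v, y) \<in> r" "\<beta> u v \<noteq> 0"
        by (auto simp: FI_supp_def)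
      obtain w where w: "(u, w) \<in> r" "u \<noteq> w" "(w, v) \<in> r" "\<alpha> u w \<noteq> 0"
        using start a by blast
      then have 1: "(u, w) \<in> FI_supp r \<alpha> x y"
        using a poset_trans by (auto simp: FI_supp_def dest: transD)
      have "(\<Sum>z\<in>Z u v. \<beta> u z * \<alpha> z v) \<noteq> 0" using a by (auto simp: \<beta>_rec[of u v])
      then obtain z where "z \<in> Z u v" by (metis empty_iff sum.neutral)
      then have "(z, v) \<in> FI_supp r \<alpha> x y"
        using a poset_trans by (auto simp: Z_def FI_supp_def dest: transD)
      with 1 show "(u, v) \<in> fst ` FI_supp r \<alpha> x y \<times> snd ` FI_supp r \<alpha> x y"
        by force
    qed
  qed (simp add: finite_FI_supp[OF \<alpha>])
  then have \<beta>: "\<beta> \<in> FI_carrier r" by (auto simp: FI_carrier_iff \<beta>_zero)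
  have "FI_mult r \<beta> \<alpha> x y = diag_idem X x y" for x y
  proof -
    consider "x = y" | "(x, y) \<notin> r" "x \<noteq> y" | "(x, y) \<in> r" "x \<noteq> y" by blast
    then show ?thesis
    proof cases
      case 1
      then show ?thesis
        using nz FI_carrier_zero[OF \<alpha>, of x x] poset_sub
        by (auto simp: FI_mult_diag[OF \<beta> \<alpha>] \<beta>_rec diag_idem_def)
    next
      case 2
      then show ?thesis by (simp add: FI_mult_outside diag_idem_def)
    next
      case 3
      have "\<alpha> y y \<noteq> 0" using 3 poset_sub nz by auto
      \<comment> \<open>The recursion is made so that the summand at y, \<beta> x y * \<alpha> y y,
        cancels the sum over \<open>Z x y\<close>.\<close>
      moreover have "FI_mult r \<beta> \<alpha> x y = (\<Sum>z\<in>insert y (Z x y). \<beta> x z * \<alpha> z y)"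
        by (intro FI_mult_eq_sum \<beta> \<alpha>) (auto simp: finZ, auto simp: Z_def)
      moreover have "y \<notin> Z x y" by (simp add: Z_def)
      ultimately show ?thesis
        using 3 finZ by (simp add: \<beta>_rec[of x y] diag_idem_def)
    qed
  qed
  then show ?thesis using that \<beta> by blast
qed

text \<open>Diagonal entries multiply, so those of a unit are nonzero. Conversely, the recursion
  yields only a left inverse \<beta>; its diagonal is again nonzero, so \<beta> has a left inverse
  \<gamma>, and \<gamma> = \<gamma>(\<beta>\<alpha>) = (\<gamma>\<beta>)\<alpha> = \<alpha> makes
  \<beta> two-sided.\<close>

lemma FI_Units_iff:
  fixes \<alpha> :: "'a \<Rightarrow> 'a \<Rightarrow> 'b::field"
  assumes \<alpha>: "\<alpha> \<in> carrier (FI X r)"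
  shows "\<alpha> \<in> Units (FI X r) \<longleftrightarrow> (\<forall>x\<in>X. \<alpha> x x \<noteq> 0)"
proof
  assume "\<alpha> \<in> Units (FI X r)"
  then obtain \<beta> where "\<beta> \<in> FI_carrier r" and e: "FI_mult r \<beta> \<alpha> = diag_idem X"
    by (auto simp: Units_def FI_def)
  then have "\<beta> x x * \<alpha> x x = diag_idem X x x" for x
    using \<alpha> FI_mult_diag[of \<beta> \<alpha> x] by (simp add: FI_def)
  then show "\<forall>x\<in>X. \<alpha> x x \<noteq> 0"
    by (metis diag_idem_def mult_zero_right zero_neq_one)
next
  assume nz: "\<forall>x\<in>X. \<alpha> x x \<noteq> 0"
  have \<alpha>: "\<alpha> \<in> FI_carrier r" using \<alpha> by (simp add: FI_def)
  have D: "(diag_idem X :: 'a \<Rightarrow> 'a \<Rightarrow> 'b) \<in> FI_carrier r"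
    by (rule diag_idem_carrier[OF poset_refl]) simp
  obtain \<beta> where \<beta>: "\<beta> \<in> FI_carrier r" "FI_mult r \<beta> \<alpha> = diag_idem X"
    using FI_left_inverse \<alpha> nz by blast
  have "\<beta> x x \<noteq> 0" if "x \<in> X" for x
    using FI_mult_diag[OF \<beta>(1) \<alpha>, of x] \<beta>(2) that by (auto simp: diag_idem_def)
  then obtain \<gamma> where \<gamma>: "\<gamma> \<in> FI_carrier r" "FI_mult r \<gamma> \<beta> = diag_idem X"
    using FI_left_inverse \<beta>(1) by blast
  \<comment> \<open>\<open>FI_mult_assoc\<close> asks that both inner products lie in the carrier;
    here both equal \<open>diag_idem X\<close>, so \<open>D\<close> provides this.\<close>
  have "\<gamma> = \<alpha>"
    using FI_mult_assoc[OF \<gamma>(1) \<beta>(1) \<alpha>] D \<beta>(2) \<gamma>(2) FI_mult_one(1)[OF \<alpha>] FI_mult_one(2)[OF \<gamma>(1)]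
    by simp
  then show "\<alpha> \<in> Units (FI X r)"
    using \<alpha> \<beta> \<gamma> by (auto simp: Units_def FI_def)
qed

lemma FI_bit_Units_iff:
  fixes \<alpha> :: "'a \<Rightarrow> 'a \<Rightarrow> bit"
  assumes "\<alpha> \<in> carrier (FI X r)"
  shows "\<alpha> \<in> Units (FI X r) \<longleftrightarrow> L1 X \<alpha> = X"
  using FI_Units_iff[OF assms] by (auto simp: L1_def)

end

section \<open>Strong preservers and injectivity of \<open>lam\<close>\<close>

theorem corollary2p31:
  fixes X :: "'a set" and r :: "'a rel"
    and lam :: "'a set \<Rightarrow> 'a set"
    and \<psi> \<phi> :: "('a \<Rightarrow> 'a \<Rightarrow> bit) \<Rightarrow> ('a \<Rightarrow> 'a \<Rightarrow> bit)"
  assumes poset: "partial_order_on X r"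
    and lam_hom: "lam \<in> hom (Pow_group X) (Pow_group X)"
    and lam_X: "lam X = X"
    and \<psi>_linear: "linear_into (FI X r) (FI_J X r) \<psi>"
    and \<psi>_one: "\<psi> \<one>\<^bsub>FI X r\<^esub> = \<zero>\<^bsub>FI X r\<^esub>"
    and \<phi>_def: "\<forall>\<alpha>\<in>carrier (FI X r). \<phi> \<alpha> = diag_idem (lam (L1 X \<alpha>)) \<oplus>\<^bsub>FI X r\<^esub> \<psi> \<alpha>"
    and \<phi>_unital: "unital_map (FI X r) \<phi>"
    and \<phi>_linear: "linear_into (FI X r) (carrier (FI X r)) \<phi>"
    and \<phi>_preserver: "invertibility_preserver (FI X r) \<phi>"
  shows "strong_invertibility_preserver (FI X r) \<phi> \<longleftrightarrow> inj_on lam (Pow X)"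
proof -
  note Units_iff = FI_bit_Units_iff[OF poset]
  have lam_sub: "lam A \<subseteq> X" if "A \<subseteq> X" for A
    using lam_hom that by (auto simp: hom_def Pow_group_def)
  have lam_diff: "lam (sym_diff A B) = sym_diff (lam A) (lam B)" if "A \<subseteq> X" "B \<subseteq> X" for A B
    using lam_hom that by (simp add: hom_def Pow_group_def)
  have unit_image: "\<phi> \<alpha> \<in> Units (FI X r) \<longleftrightarrow> lam (L1 X \<alpha>) = X"
    if \<alpha>: "\<alpha> \<in> carrier (FI X r)" for \<alpha>
  proof -
    have "\<phi> \<alpha> \<in> carrier (FI X r)" "\<psi> \<alpha> \<in> FI_J X r"
      using \<alpha> \<phi>_linear \<psi>_linear by (auto simp: linear_into_def)
    moreover from this(2) have "L1 X (\<phi> \<alpha>) = X \<inter> lam (L1 X \<alpha>)"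
      using \<phi>_def \<alpha> by (auto simp: L1_def FI_def FI_J_def diag_idem_def)
    moreover have "lam (L1 X \<alpha>) \<subseteq> X" by (rule lam_sub) (auto simp: L1_def)
    ultimately show ?thesis using Units_iff by auto
  qed
  show ?thesis
  proof
    assume strong: "strong_invertibility_preserver (FI X r) \<phi>"
    show "inj_on lam (Pow X)"
    proof (rule inj_onI)
      fix A B assume AB: "A \<in> Pow X" "B \<in> Pow X" "lam A = lam B"
      \<comment> \<open>The symmetric difference of A and B lies in the kernel of
        \<open>lam\<close>. Translating it by \<open>X\<close> gives a set with image
        \<open>X\<close>, so \<open>diag_idem C\<close> is sent to a unit; strength forces C = X, so
        the kernel element is empty.\<close>
      define C where "C = sym_diff X (sym_diff A B)"
      have C: "(diag_idem C :: _ \<Rightarrow> _ \<Rightarrow> bit) \<in> carrier (FI X r)"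
        using AB diag_idem_carrier[of X r C] poset_refl[OF poset] by (auto simp: C_def FI_def)
      have L1_C: "L1 X (diag_idem C :: _ \<Rightarrow> _ \<Rightarrow> bit) = C"
        using AB by (auto simp: L1_def diag_idem_def C_def)
      have "lam C = sym_diff (lam X) (sym_diff (lam A) (lam B))"
        unfolding C_def using AB lam_diff[of X "sym_diff A B"] lam_diff[of A B] by auto
      then have "lam C = X" using AB lam_X by simp
      then have "C = X"
        using strong C unit_image[OF C, unfolded L1_C] Units_iff[OF C, unfolded L1_C]
        by (simp add: strong_invertibility_preserver_def)
      then show "A = B" using AB by (auto simp: C_def)
    qed
  next
    assume inj: "inj_on lam (Pow X)"
    have "\<alpha> \<in> Units (FI X r) \<longleftrightarrow> \<phi> \<alpha> \<in> Units (FI X r)" if \<alpha>: "\<alpha> \<in> carrier (FI X r)" for \<alpha>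
    proof -
      have "L1 X \<alpha> \<subseteq> X" by (auto simp: L1_def)
      then have "lam (L1 X \<alpha>) = X \<longleftrightarrow> L1 X \<alpha> = X"
        using inj_on_eq_iff[OF inj, of "L1 X \<alpha>" X] lam_X by simp
      then show ?thesis using unit_image[OF \<alpha>] Units_iff[OF \<alpha>] by simp
    qed
    then show "strong_invertibility_preserver (FI X r) \<phi>"
      using \<phi>_preserver by (simp add: strong_invertibility_preserver_def)
  qed
qed

end
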